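(* Any $r$-uniform $\ell$-cycle of order $q$ such that $r$ divides $q$ is non-stabilizable.
   Context: A hypergraph $\mathbb H=(V,\mathcal H)$ consists of a finite node set $V$ and a finite set $\mathcal H$ of subsets of $V$ (hyperedges) with union $V$; its order is $q=|V|$. All hypergraphs are assumed simple (no hyperedge is contained in another one) and connected (the graph whose vertices are the hyperedges, with two hyperedges adjacent when they intersect, is connected). An $r$-uniform hypergraph (all hyperedges have cardinality $r$), $r\ge2$, is an $\ell$-(Hamiltonian) cycle, $0<\ell<r$, if there is an ordering $(v_1,\dots,v_q)$ of the nodes such that every hyperedge consists of $r$ consecutive nodes modulo $q$, and any two consecutive hyperedges (in the induced cyclic order) intersect in exactly $\ell$ nodes. $\mathscr M(V)$ is the set of probability measures $\mu$ on $V$ with $\mu(i)>0$ for all $i$. Matching model $(\mathbb H,\Phi,\mu)$: at each time $n\ge1$ one item enters; its class $C_n\in V$ is drawn from $\mu$, i.i.d. If the buffer contains a set of items whose classes form, together with $C_n$, a hyperedge (one item per class), the policy $\Phi$ selects one such set and these items leave immediately together with the incoming item (a match is always performed whenever possible); otherwise the incoming item is stored. $W_n$ is the word over $V$ listing the classes of unmatched items after the arrival at time $n$, in order of arrival; it takes values in the set of words in which, for each hyperedge, some class of the hyperedge does not occur. $\Phi$ is admissible if the choice of the match depends solely on the queue detail (the word) upon arrival and the incoming class, and possibly on an independent uniform draw in case of a tie; then $(W_n)$ is a Markov chain. The model is stable if $(W_n)$ is positive recurrent; $\mathrm{Stab}(\mathbb H,\Phi)$ is the set of $\mu\in\mathscr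 M(V)$ for which it is stable. $\mathbb H$ is non-stabilizable if $\mathrm{Stab}(\mathbb H,\Phi)=\emptyset$ for every admissible $\Phi$. *)

theory Defs
  imports "HOL-Probability.Probability"
begin

section \<open>Hypergraphs and Hamiltonian cycles\<close>

definition hypergraph :: "'a set \<Rightarrow> 'a set set \<Rightarrow> bool" where
  "hypergraph V H \<longleftrightarrow> finite V \<and> finite H \<and> \<Union>H = V"

definition simple_hypergraph :: "'a set set \<Rightarrow> bool" where
  "simple_hypergraph H \<longleftrightarrow> (\<forall>e\<in>H. \<forall>f\<in>H. e \<subseteq> f \<longrightarrow> e = f)"

definition connected_hypergraph :: "'a set set \<Rightarrow> bool" where
  "connected_hypergraph H \<longleftrightarrow>
     (\<forall>e\<in>H. \<forall>f\<in>H. (e, f) \<in> {(a, b). a \<in> H \<and> b \<in> H \<and> a \<inter> b \<noteq> {}}\<^sup>*)"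

definition uniform_hypergraph :: "nat \<Rightarrow> 'a set set \<Rightarrow> bool" where
  "uniform_hypergraph r H \<longleftrightarrow> (\<forall>e\<in>H. card e = r)"

text \<open>The \<open>r\<close> consecutive nodes, modulo \<open>q\<close>, starting at position \<open>s\<close> of the ordering
  \<open>v 0, \<dots>, v (q - 1)\<close>.\<close>

definition cyclic_window :: "nat \<Rightarrow> (nat \<Rightarrow> 'a) \<Rightarrow> nat \<Rightarrow> nat \<Rightarrow> 'a set" where
  "cyclic_window q v r s = (\<lambda>j. v ((s + j) mod q)) ` {..<r}"

text \<open>The hyperedges are listed without repetition in the cyclic order induced by \<open>v\<close>, that is, by
  increasing starting position \<open>s 0 < \<dots> < s (m - 1)\<close>.  A hypergraph with a single hyperedge has no
  two consecutive hyperedges, so nothing is required of it in the last conjunct.\<close>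

definition hamiltonian_cycle :: "nat \<Rightarrow> nat \<Rightarrow> 'a set \<Rightarrow> 'a set set \<Rightarrow> bool" where
  "hamiltonian_cycle r l V H \<longleftrightarrow>
     2 \<le> r \<and> 0 < l \<and> l < r \<and> uniform_hypergraph r H \<and>
     (\<exists>v s m.
        bij_betw v {..<card V} V \<and>
        strict_mono_on {..<m} s \<and> s ` {..<m} \<subseteq> {..<card V} \<and>
        bij_betw (\<lambda>k. cyclic_window (card V) v r (s k)) {..<m} H \<and>
        (1 < m \<longrightarrow> (\<forall>k<m.
           card (cyclic_window (card V) v r (s k) \<inter>
                 cyclic_window (card V) v r (s (Suc k mod m))) = l)))"


section \<open>The matching model\<close>

text \<open>State space: the words over \<open>V\<close> in which no hyperedge is completely represented.\<close>

definition buffers :: "'a set \<Rightarrow> 'a set set \<Rightarrow> 'a list set" where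
  "buffers V H = {w \<in> lists V. \<forall>e\<in>H. \<exists>i\<in>e. i \<notin> set w}"

text \<open>Stored items are identified by their positions in the word \<open>w\<close>, so that several items of
  the same class are distinguished.  A possible match of an incoming item of class \<open>c\<close> is a set of
  positions carrying pairwise different classes, all different from \<open>c\<close>, which form a hyperedge
  together with \<open>c\<close>.\<close>

definition possible_matches :: "'a set set \<Rightarrow> 'a list \<Rightarrow> 'a \<Rightarrow> nat set set" where
  "possible_matches H w c =
     {I. I \<subseteq> {..<length w} \<and> inj_on ((!) w) I \<and> c \<notin> (!) w ` I \<and> insert c ((!) w ` I) \<in> H}"

text \<open>A policy maps the word upon arrival, the incoming class and the value of a draw from the
  uniform distribution on \<open>[0, 1]\<close> to a set of positions.\<close>

type_synonym 'a policy = "'a list \<Rightarrow> 'a \<Rightarrow> real \<Rightarrow> nat set"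

text \<open>Membership in the measurable function space says both that the selected set is a possible
  match for every value of the draw and that the selection is measurable in the draw.  The values of
  the policy are irrelevant when there is no possible match.\<close>

definition admissible :: "'a set \<Rightarrow> 'a set set \<Rightarrow> 'a policy \<Rightarrow> bool" where
  "admissible V H \<Phi> \<longleftrightarrow>
     (\<forall>w\<in>buffers V H. \<forall>c\<in>V. possible_matches H w c \<noteq> {} \<longrightarrow>
        \<Phi> w c \<in> measurable (restrict_space borel {0..1}) (count_space (possible_matches H w c)))"

definition arrival :: "'a set set \<Rightarrow> 'a policy \<Rightarrow> 'a list \<Rightarrow> 'a \<Rightarrow> real \<Rightarrow> 'a list" where
  "arrival H \<Phi> w c u =
     (if possible_matches H w c = {} then w @ [c] else nths w (- \<Phi> w c u))"

text \<open>The canonical probability space of the i.i.d. pairs of an incoming class, of law \<open>\<mu>\<close>, and an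
  independent uniform draw.  Coordinate \<open>n\<close> belongs to the arrival at time \<open>n + 1\<close>.\<close>

definition input_space :: "'a pmf \<Rightarrow> (nat \<Rightarrow> 'a \<times> real) measure" where
  "input_space \<mu> =
     PiM UNIV (\<lambda>_. measure_pmf \<mu> \<Otimes>\<^sub>M uniform_measure lborel {0..1})"

primrec buffer_process ::
  "'a set set \<Rightarrow> 'a policy \<Rightarrow> 'a list \<Rightarrow> (nat \<Rightarrow> 'a \<times> real) \<Rightarrow> nat \<Rightarrow> 'a list" where
  "buffer_process H \<Phi> w \<omega> 0 = w"
| "buffer_process H \<Phi> w \<omega> (Suc n) =
     arrival H \<Phi> (buffer_process H \<Phi> w \<omega> n) (fst (\<omega> n)) (snd (\<omega> n))"

text \<open>The infimum over the empty set is \<open>\<infinity>\<close>.\<close>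

definition return_time ::
  "'a set set \<Rightarrow> 'a policy \<Rightarrow> 'a list \<Rightarrow> (nat \<Rightarrow> 'a \<times> real) \<Rightarrow> ennreal" where
  "return_time H \<Phi> w \<omega> = (INF n\<in>{n. 1 \<le> n \<and> buffer_process H \<Phi> w \<omega> n = w}. of_nat n)"

text \<open>Positive recurrence of the Markov chain: every state has a finite mean return time.\<close>

definition stable :: "'a set \<Rightarrow> 'a set set \<Rightarrow> 'a policy \<Rightarrow> 'a pmf \<Rightarrow> bool" where
  "stable V H \<Phi> \<mu> \<longleftrightarrow>
     (\<forall>w\<in>buffers V H. (\<integral>\<^sup>+\<omega>. return_time H \<Phi> w \<omega> \<partial>input_space \<mu>) < \<infinity>)"

definition Stab :: "'a set \<Rightarrow> 'a set set \<Rightarrow> 'a policy \<Rightarrow> 'a pmf set" where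
  "Stab V H \<Phi> = {\<mu>. set_pmf \<mu> = V \<and> stable V H \<Phi> \<mu>}"

definition non_stabilizable :: "'a set \<Rightarrow> 'a set set \<Rightarrow> bool" where
  "non_stabilizable V H \<longleftrightarrow> (\<forall>\<Phi>. admissible V H \<Phi> \<longrightarrow> Stab V H \<Phi> = {})"

end

theory Submission
  imports Defs
begin

text \<open>
  Weight the nodes by \<open>+ 1\<close> on the positions \<open>\<equiv> 0\<close> modulo \<open>r\<close> of the cyclic ordering, by \<open>- 1\<close> on the
  positions \<open>\<equiv> 1\<close>, and by \<open>0\<close> elsewhere.  Because \<open>r\<close> divides \<open>q\<close>, reduction modulo \<open>q\<close> does not change
  residues modulo \<open>r\<close>, so \<open>r\<close> cyclically consecutive nodes meet every residue class exactly once and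
  every hyperedge has total weight \<open>0\<close> (\<open>sum_cyclic_window_residues\<close>).

  A match removes one item of each class of a hyperedge.  Hence no policy can influence the total
  weight of the buffer: it is the sum of the weights of the items that have arrived, that is, a random
  walk on the integers with i.i.d. steps in \<open>{- 1, 0, 1}\<close> (\<open>buffer_process_weight\<close>).  The buffer can be
  empty again only when this walk is back at \<open>0\<close>.

  Such a walk, if not constant, takes infinitely long on average to return to \<open>0\<close>.  Changing the sign
  of the weights if necessary, let the drift be nonnegative; then the step \<open>+ 1\<close> has positive probability
  \<open>p\<close>.  A walk with nonnegative drift that is stopped when it reaches \<open>0\<close> is a submartingale, and in
  \<open>n\<close> steps from \<open>x\<close> it climbs no higher than \<open>x + n\<close>; so it is still positive after \<open>n\<close> steps with
  probability at least \<open>x / (x + n)\<close> (\<open>emeasure_walk_stays_positive\<close>).  Starting from \<open>0\<close>, the walk stays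
  positive during the times \<open>1, \<dots>, n + 1\<close> with probability at least \<open>p / (n + 1)\<close>, and the harmonic series
  diverges.  Therefore the empty buffer has infinite mean return time
  (\<open>balanced_weight_imp_non_stabilizable\<close>).
\<close>


section \<open>Skip-free random walks with nonnegative drift\<close>

definition walk :: "('b \<Rightarrow> int) \<Rightarrow> (nat \<Rightarrow> 'b) \<Rightarrow> nat \<Rightarrow> int" where
  "walk \<xi> \<omega> n = (\<Sum>i<n. \<xi> (\<omega> i))"

lemma walk_0 [simp]: "walk \<xi> \<omega> 0 = 0"
  by (simp add: walk_def)

lemma walk_case_nat_Suc: "walk \<xi> (case_nat s \<omega>) (Suc k) = \<xi> s + walk \<xi> \<omega> k"
  unfolding walk_def by (subst sum.lessThan_Suc_shift) simp

context sequence_space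
begin

lemma walk_measurable:
  assumes [measurable]: "\<xi> \<in> measurable M (count_space UNIV)"
  shows "(\<lambda>\<omega>. walk \<xi> \<omega> k) \<in> measurable S (count_space UNIV)"
proof (induction k)
  case (Suc k)
  note [measurable] = Suc.IH
  have "(\<lambda>\<omega>. walk \<xi> \<omega> k + \<xi> (\<omega> k)) \<in> measurable S (count_space UNIV)"
    by measurable
  then show ?case by (simp add: walk_def)
qed simp

lemma pred_walk:
  assumes "\<xi> \<in> measurable M (count_space UNIV)"
  shows "Measurable.pred S (\<lambda>\<omega>. \<forall>k. Q k \<longrightarrow> P (walk \<xi> \<omega> k))"
proof -
  have "Measurable.pred S (\<lambda>\<omega>. P (walk \<xi> \<omega> k))" for k
    by (rule measurable_compose[OF walk_measurable[OF assms]]) simp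
  then show ?thesis
    by (intro pred_intros_countable pred_intros_logic) auto
qed

text \<open>The Markov property at time \<open>1\<close>: an i.i.d. sequence is a first term followed by an independent
  copy of the sequence.\<close>

lemma emeasure_first_step:
  assumes [measurable]: "Measurable.pred S P"
  shows "emeasure S {\<omega>\<in>space S. P \<omega>} =
    (\<integral>\<^sup>+ s. emeasure S {\<omega>\<in>space S. P (case_nat s \<omega>)} \<partial>M)"
proof -
  have "emeasure S {\<omega>\<in>space S. P \<omega>} =
      emeasure (distr (M \<Otimes>\<^sub>M S) S (\<lambda>(s, \<omega>). case_nat s \<omega>)) {\<omega>\<in>space S. P \<omega>}"
    by (simp only: PiM_iter)
  also have "\<dots> = emeasure (M \<Otimes>\<^sub>M S)
      ((\<lambda>(s, \<omega>). case_nat s \<omega>) -` {\<omega>\<in>space S. P \<omega>} \<inter> space (M \<Otimes>\<^sub>M S))"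
    by (rule emeasure_distr) measurable
  also have "\<dots> = (\<integral>\<^sup>+ s. emeasure S (Pair s -` ((\<lambda>(s, \<omega>). case_nat s \<omega>) -` {\<omega>\<in>space S. P \<omega>}
      \<inter> space (M \<Otimes>\<^sub>M S))) \<partial>M)"
    by (rule P.emeasure_pair_measure_alt) measurable
  also have "\<dots> = (\<integral>\<^sup>+ s. emeasure S {\<omega>\<in>space S. P (case_nat s \<omega>)} \<partial>M)"
  proof (rule nn_integral_cong)
    fix s assume "s \<in> space M"
    then have "Pair s -` ((\<lambda>(s, \<omega>). case_nat s \<omega>) -` {\<omega>\<in>space S. P \<omega>} \<inter> space (M \<Otimes>\<^sub>M S))
        = {\<omega>\<in>space S. P (case_nat s \<omega>)}"
      by (auto simp: space_pair_measure space_PiM PiE_iff split: nat.splits)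
    then show "emeasure S (Pair s -` ((\<lambda>(s, \<omega>). case_nat s \<omega>) -` {\<omega>\<in>space S. P \<omega>}
        \<inter> space (M \<Otimes>\<^sub>M S))) = emeasure S {\<omega>\<in>space S. P (case_nat s \<omega>)}" by simp
  qed
  finally show ?thesis .
qed

text \<open>By conditioning on the first step, the bound for \<open>n + 1\<close> follows from the bounds \<open>y / (y + n)\<close> at
  the neighbours \<open>y = x + \<xi> s\<close> of \<open>x\<close>.  As \<open>y \<le> x + 1\<close>, all of them are at least \<open>y / (x + 1 + n)\<close>, which
  is linear in \<open>y\<close>, so that its mean is controlled by the drift alone.  Steps of size at most \<open>1\<close> cannot
  jump over \<open>0\<close>; this keeps the induction within \<open>0 \<le> x\<close>.  At \<open>x = 0\<close> the bound is \<open>0\<close>, also for \<open>n = 0\<close>,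
  where it reads \<open>0 / 0\<close>.\<close>

lemma emeasure_walk_stays_positive:
  fixes \<xi> :: "'a \<Rightarrow> int" and x :: int
  assumes meas [measurable]: "\<xi> \<in> measurable M (count_space UNIV)"
    and bound: "\<And>s. \<bar>\<xi> s\<bar> \<le> 1"
    and drift: "0 \<le> (\<integral>s. real_of_int (\<xi> s) \<partial>M)"
    and "0 \<le> x"
  shows "ennreal (x / (x + real n)) \<le> emeasure S {\<omega>\<in>space S. \<forall>k\<le>n. 0 < x + walk \<xi> \<omega> k}"
  using \<open>0 \<le> x\<close>
proof (induction n arbitrary: x)
  case 0
  show ?case
  proof (cases "x = 0")
    case False
    with 0 show ?thesis by (simp add: P.emeasure_space_1)
  qed simp
next
  case (Suc n)
  show ?case
  proof (cases "x = 0")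
    case False
    with Suc.prems have x: "1 \<le> x" by simp
    have int: "integrable M (\<lambda>s. real_of_int (\<xi> s))"
      using bound by (intro M.integrable_const_bound[where B = 1])
        (auto simp flip: of_int_abs)
    have shift: "(\<forall>k\<le>Suc n. 0 < x + walk \<xi> (case_nat s \<omega>) k) \<longleftrightarrow>
        (\<forall>k\<le>n. 0 < (x + \<xi> s) + walk \<xi> \<omega> k)" for s \<omega>
      using x All_less_Suc2[of "Suc n" "\<lambda>k. 0 < x + walk \<xi> (case_nat s \<omega>) k"]
      by (simp add: less_Suc_eq_le walk_case_nat_Suc add.assoc)
    have nonneg: "0 \<le> x + \<xi> s" for s
      using bound[of s] x by linarith
    have "x / (x + real (Suc n)) \<le> (x + (\<integral>s. real_of_int (\<xi> s) \<partial>M)) / (x + real (Suc n))"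
      using drift x by (intro divide_right_mono) auto
    also have "\<dots> = (\<integral>s. (x + real_of_int (\<xi> s)) / (x + real (Suc n)) \<partial>M)"
      using int by (simp add: M.prob_space)
    finally have "ennreal (x / (x + real (Suc n))) \<le>
        ennreal (\<integral>s. (x + real_of_int (\<xi> s)) / (x + real (Suc n)) \<partial>M)"
      by (rule ennreal_leI)
    also have "\<dots> = (\<integral>\<^sup>+s. ennreal ((x + real_of_int (\<xi> s)) / (x + real (Suc n))) \<partial>M)"
    proof (rule nn_integral_eq_integral[symmetric])
      show "integrable M (\<lambda>s. (x + real_of_int (\<xi> s)) / (x + real (Suc n)))"
        using int by simp
      show "AE s in M. 0 \<le> (x + real_of_int (\<xi> s)) / (x + real (Suc n))"
      proof (rule AE_I2)
        fix s
        have "0 \<le> real_of_int (x + \<xi> s)" using nonneg by (simp only: of_int_0_le_iff)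
        with x show "0 \<le> (x + real_of_int (\<xi> s)) / (x + real (Suc n))" by simp
      qed
    qed
    also have "\<dots> \<le> (\<integral>\<^sup>+s. emeasure S {\<omega>\<in>space S. \<forall>k\<le>n. 0 < (x + \<xi> s) + walk \<xi> \<omega> k} \<partial>M)"
    proof (rule nn_integral_mono)
      fix s
      have "(x + real_of_int (\<xi> s)) / (x + real (Suc n)) \<le>
          real_of_int (x + \<xi> s) / (real_of_int (x + \<xi> s) + real n)"
      proof (cases "x + \<xi> s = 0")
        case True
        then have "real_of_int x + real_of_int (\<xi> s) = 0" by linarith
        then show ?thesis by simp
      next
        case False
        then have "0 < real_of_int (x + \<xi> s)" using nonneg[of s] by linarith
        moreover have "real_of_int (\<xi> s) \<le> 1" using bound[of s] by linarith
        ultimately show ?thesis by (simp add: frac_le)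
      qed
      then show "ennreal ((x + real_of_int (\<xi> s)) / (x + real (Suc n))) \<le>
          emeasure S {\<omega>\<in>space S. \<forall>k\<le>n. 0 < (x + \<xi> s) + walk \<xi> \<omega> k}"
        using Suc.IH[OF nonneg] by (meson ennreal_leI order.trans)
    qed
    also have "\<dots> = (\<integral>\<^sup>+s. emeasure S
        {\<omega>\<in>space S. \<forall>k\<le>Suc n. 0 < x + walk \<xi> (case_nat s \<omega>) k} \<partial>M)"
      by (simp only: shift)
    also have "\<dots> = emeasure S {\<omega>\<in>space S. \<forall>k\<le>Suc n. 0 < x + walk \<xi> \<omega> k}"
      by (rule emeasure_first_step[symmetric]) (rule pred_walk[OF meas])
    finally show ?thesis .
  qed simp
qed

text \<open>The sum is the mean \<open>\<Sum>\<^sub>n P(T > n)\<close> of the first positive time \<open>T\<close> at which the walk is not positive.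
  It diverges because an up-step leads to \<open>1\<close>, from where the walk survives \<open>n\<close> steps with
  probability at least \<open>1 / (n + 1)\<close>.\<close>

lemma suminf_emeasure_walk_positive:
  assumes meas [measurable]: "\<xi> \<in> measurable M (count_space UNIV)"
    and bound: "\<And>s. \<bar>\<xi> s\<bar> \<le> 1"
    and drift: "0 \<le> (\<integral>s. real_of_int (\<xi> s) \<partial>M)"
    and up: "0 < emeasure M {s\<in>space M. \<xi> s = 1}"
  shows "(\<Sum>n. emeasure S {\<omega>\<in>space S. \<forall>k\<in>{1..n}. 0 < walk \<xi> \<omega> k}) = \<infinity>"
proof -
  define B where "B n = {\<omega>\<in>space S. \<forall>k\<in>{1..n}. 0 < walk \<xi> \<omega> k}" for n
  define p where "p = measure M {s\<in>space M. \<xi> s = 1}"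
  have p: "0 < p" "emeasure M {s\<in>space M. \<xi> s = 1} = ennreal p"
    using up by (auto simp: p_def M.emeasure_eq_measure)
  have "ennreal (p * inverse (real (Suc n))) \<le> emeasure S (B (Suc n))" for n
  proof -
    have "ennreal (p * inverse (real (Suc n))) =
        (\<integral>\<^sup>+s. ennreal (inverse (real (Suc n))) * indicator {s\<in>space M. \<xi> s = 1} s \<partial>M)"
      using p by (subst nn_integral_cmult_indicator) (auto simp: ennreal_mult mult.commute)
    also have "\<dots> \<le> (\<integral>\<^sup>+s. emeasure S
        {\<omega>\<in>space S. \<forall>k\<in>{1..Suc n}. 0 < walk \<xi> (case_nat s \<omega>) k} \<partial>M)"
    proof (rule nn_integral_mono)
      fix s
      show "ennreal (inverse (real (Suc n))) * indicator {s\<in>space M. \<xi> s = 1} s \<le>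
        emeasure S {\<omega>\<in>space S. \<forall>k\<in>{1..Suc n}. 0 < walk \<xi> (case_nat s \<omega>) k}"
      proof (cases "s \<in> space M \<and> \<xi> s = 1")
        case True
        have "(\<forall>k\<in>{1..Suc n}. 0 < walk \<xi> (case_nat s \<omega>) k) \<longleftrightarrow> (\<forall>k\<le>n. 0 < 1 + walk \<xi> \<omega> k)" for \<omega>
        proof -
          have "{1..Suc n} = Suc ` {..n}" by (auto simp: image_Suc_atMost)
          then show ?thesis using True by (simp add: walk_case_nat_Suc Ball_def[of "{..n}"] del: image_Suc_atMost)
        qed
        then show ?thesis
          using emeasure_walk_stays_positive[OF meas bound drift, of 1 n] True
          by (simp add: inverse_eq_divide)
      qed auto
    qed
    also have "\<dots> = emeasure S (B (Suc n))"
      unfolding B_def Ball_def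
      by (rule emeasure_first_step[symmetric]) (rule pred_walk[OF meas])
    finally show ?thesis .
  qed
  then have le: "(\<Sum>n. ennreal (p * inverse (real (Suc n)))) \<le> (\<Sum>n. emeasure S (B (Suc n)))"
    by (intro suminf_le) auto
  have "(\<Sum>n. ennreal (p * inverse (real (Suc n)))) = \<infinity>"
  proof (rule ccontr)
    assume "\<not> ?thesis"
    then have "summable (\<lambda>n. p * inverse (real (Suc n)))"
      using p(1) by (intro summable_suminf_not_top) auto
    then have "summable (\<lambda>n. inverse (real (Suc n)))"
      using p(1) by (simp add: summable_cmult_iff)
    then show False
      using not_summable_harmonic[where 'a = real] summable_Suc_iff[of "\<lambda>n. inverse (real n)"]
      by blast
  qed
  with le have "\<infinity> = (\<Sum>n. emeasure S (B (Suc n)))" by (simp add: top_unique)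
  also have "\<dots> \<le> (\<Sum>n. emeasure S (B n))"
    using suminf_offset[of "\<lambda>n. emeasure S (B n)" 1] by simp
  finally show ?thesis by (simp add: B_def top_unique)
qed

end


section \<open>The weight of the buffer\<close>

lemma sum_list_nths_complement:
  fixes f :: "'a \<Rightarrow> 'b::ab_group_add"
  assumes "I \<subseteq> {..<length w}"
  shows "sum_list (map f (nths w (- I))) = sum_list (map f w) - (\<Sum>i\<in>I. f (w ! i))"
  using assms
proof (induction w arbitrary: I rule: rev_induct)
  case (snoc x w)
  have I: "I \<inter> {..<length w} \<subseteq> {..<length w}" by auto
  have nths_eq: "nths w (- (I \<inter> {..<length w})) = nths w (- I)"
    unfolding nths_def by (intro arg_cong[where f = "map fst"] filter_cong)
      (auto dest: set_zip_rightD)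
  have "(\<Sum>i\<in>I. f ((w @ [x]) ! i)) =
      (\<Sum>i\<in>I \<inter> {..<length w}. f (w ! i)) + (if length w \<in> I then f x else 0)"
  proof (cases "length w \<in> I")
    case True
    with snoc.prems have "I = insert (length w) (I \<inter> {..<length w})"
      by (auto simp: less_Suc_eq)
    then have "(\<Sum>i\<in>I. f ((w @ [x]) ! i)) =
        (\<Sum>i\<in>insert (length w) (I \<inter> {..<length w}). f ((w @ [x]) ! i))"
      by (rule arg_cong)
    with True show ?thesis by (simp add: nth_append add.commute)
  next
    case False
    with snoc.prems have sub: "I \<subseteq> {..<length w}"
      by (auto simp: less_Suc_eq)
    then have "(\<Sum>i\<in>I. f ((w @ [x]) ! i)) = (\<Sum>i\<in>I. f (w ! i))"
      by (intro sum.cong) (auto simp: nth_append)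
    with False sub show ?thesis by (simp add: Int_absorb2)
  qed
  with snoc.IH[OF I] nths_eq show ?case by (auto simp: nths_append)
qed simp

lemma possible_match_of_hyperedge:
  assumes "e \<in> H" "c \<in> e" "e \<subseteq> insert c (set w)"
  shows "possible_matches H w c \<noteq> {}"
proof -
  define pos where "pos x = (SOME i. i < length w \<and> w ! i = x)" for x
  have pos: "pos x < length w \<and> w ! pos x = x" if "x \<in> e - {c}" for x
  proof -
    from that assms(3) have "\<exists>i. i < length w \<and> w ! i = x" by (auto simp: in_set_conv_nth)
    then show ?thesis unfolding pos_def by (rule someI_ex)
  qed
  then have "(!) w ` pos ` (e - {c}) = e - {c}" by (force simp: image_image)
  with pos assms(1,2) have "pos ` (e - {c}) \<in> possible_matches H w c"
    by (auto simp: possible_matches_def inj_on_def insert_absorb)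
  then show ?thesis by blast
qed

text \<open>Admissibility enters only here: measurability into the space of possible matches contains the
  statement that the selected set is one of them.\<close>

lemma policy_selects_possible_match:
  assumes "admissible V H \<Phi>" "w \<in> buffers V H" "c \<in> V" "possible_matches H w c \<noteq> {}"
    and "u \<in> {0..1}"
  shows "\<Phi> w c u \<in> possible_matches H w c"
proof -
  from assms have "\<Phi> w c \<in> measurable (restrict_space borel {0..1}) (count_space (possible_matches H w c))"
    by (auto simp: admissible_def)
  from measurable_space[OF this, of u] assms(5) show ?thesis
    by (simp add: space_restrict_space)
qed

text \<open>An item is stored only when it completes no hyperedge, so the buffer never contains a complete
  hyperedge.\<close>

lemma arrival_in_buffers:
  assumes "admissible V H \<Phi>" "w \<in> buffers V H" "c \<in> V" "u \<in> {0..1}"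
  shows "arrival H \<Phi> w c u \<in> buffers V H"
proof (cases "possible_matches H w c = {}")
  case True
  have "\<exists>i\<in>e. i \<notin> set (w @ [c])" if "e \<in> H" for e
  proof (rule ccontr)
    assume "\<not> (\<exists>i\<in>e. i \<notin> set (w @ [c]))"
    then have sub: "e \<subseteq> insert c (set w)" by auto
    moreover from assms(2) that have "\<exists>i\<in>e. i \<notin> set w" by (auto simp: buffers_def)
    ultimately have "c \<in> e" by blast
    with possible_match_of_hyperedge[OF that _ sub] True show False by blast
  qed
  with assms True show ?thesis by (auto simp: arrival_def buffers_def)
next
  case False
  have sub: "set (nths w (- \<Phi> w c u)) \<subseteq> set w" by (rule set_nths_subset)
  from assms(2) have "w \<in> lists V" and no: "\<And>e. e \<in> H \<Longrightarrow> \<exists>i\<in>e. i \<notin> set w"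
    by (auto simp: buffers_def)
  with sub have "nths w (- \<Phi> w c u) \<in> lists V" by (auto simp: in_lists_conv_set)
  moreover have "\<exists>i\<in>e. i \<notin> set (nths w (- \<Phi> w c u))" if "e \<in> H" for e
    using no[OF that] sub by blast
  ultimately show ?thesis using False by (simp add: arrival_def buffers_def)
qed

text \<open>The stored items of a match have the classes of a hyperedge without \<open>c\<close>.  When hyperedges have
  weight \<open>0\<close>, removing them changes the weight by \<open>\<xi> c\<close>, exactly as storing the item of class \<open>c\<close> does.\<close>

lemma arrival_weight:
  fixes \<xi> :: "'a \<Rightarrow> int"
  assumes balanced: "\<And>e. e \<in> H \<Longrightarrow> sum \<xi> e = 0"
    and finite: "\<And>e. e \<in> H \<Longrightarrow> finite e"
    and adm: "admissible V H \<Phi>" "w \<in> buffers V H" "c \<in> V" "u \<in> {0..1}"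
  shows "sum_list (map \<xi> (arrival H \<Phi> w c u)) = sum_list (map \<xi> w) + \<xi> c"
proof (cases "possible_matches H w c = {}")
  case False
  define I where "I = \<Phi> w c u"
  from policy_selects_possible_match[OF adm(1-3) False adm(4)]
  have I: "I \<subseteq> {..<length w}" "inj_on ((!) w) I" "c \<notin> (!) w ` I" "insert c ((!) w ` I) \<in> H"
    by (auto simp: possible_matches_def I_def)
  have "finite ((!) w ` I)" using finite[OF I(4)] by simp
  with I(2,3) balanced[OF I(4)] have "\<xi> c + (\<Sum>i\<in>I. \<xi> (w ! i)) = 0"
    by (simp add: sum.reindex)
  with sum_list_nths_complement[OF I(1), of \<xi>] False show ?thesis
    by (simp add: arrival_def I_def)
qed (simp add: arrival_def)

lemma buffer_process_weight:
  fixes \<xi> :: "'a \<Rightarrow> int"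
  assumes "\<And>e. e \<in> H \<Longrightarrow> sum \<xi> e = 0"
    and "\<And>e. e \<in> H \<Longrightarrow> finite e"
    and "admissible V H \<Phi>" "w \<in> buffers V H"
    and "\<And>i. fst (\<omega> i) \<in> V" "\<And>i. snd (\<omega> i) \<in> {0..1}"
  shows "buffer_process H \<Phi> w \<omega> n \<in> buffers V H \<and>
    sum_list (map \<xi> (buffer_process H \<Phi> w \<omega> n)) =
      sum_list (map \<xi> w) + walk (\<lambda>s. \<xi> (fst s)) \<omega> n"
proof (induction n)
  case 0
  with assms(4) show ?case by simp
next
  case (Suc n)
  with arrival_in_buffers[OF assms(3) _ assms(5,6)]
    arrival_weight[OF assms(1,2,3) _ assms(5,6)]
  show ?case by (simp add: walk_def)
qed


section \<open>Non-stabilizability from a balanced weight\<close>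

text \<open>The left-hand side is the first positive time at which the walk is not positive: the buffer cannot
  have returned before.  In this form its integral is the series of the survival probabilities of the
  walk, in which the policy does not occur.\<close>

lemma return_time_ge:
  assumes "\<And>m. 1 \<le> m \<Longrightarrow> buffer_process H \<Phi> w \<omega> m = w \<Longrightarrow> walk \<xi> \<omega> m = 0"
  shows "(\<Sum>n. indicator {\<omega>\<in>A. \<forall>k\<in>{1..n}. 0 < walk \<xi> \<omega> k} \<omega>) \<le> return_time H \<Phi> w \<omega>"
  unfolding return_time_def
proof (rule INF_greatest)
  fix m assume "m \<in> {n. 1 \<le> n \<and> buffer_process H \<Phi> w \<omega> n = w}"
  with assms have m: "1 \<le> m" "walk \<xi> \<omega> m = 0" by auto
  define B where "B n = {\<omega>\<in>A. \<forall>k\<in>{1..n}. 0 < walk \<xi> \<omega> k}" for n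
  have "\<omega> \<notin> B n" if "m \<le> n" for n
    using that m by (force simp: B_def)
  then have "(\<Sum>n. indicator (B n) \<omega>) = (\<Sum>n<m. indicator (B n) \<omega> :: ennreal)"
    by (intro suminf_finite) (auto simp: not_less)
  also have "\<dots> \<le> (\<Sum>n<m. 1)" by (intro sum_mono) (simp add: indicator_def)
  finally show "(\<Sum>n. indicator {\<omega>\<in>A. \<forall>k\<in>{1..n}. 0 < walk \<xi> \<omega> k} \<omega>) \<le> (of_nat m :: ennreal)"
    by (simp add: B_def)
qed

text \<open>A weight that vanishes on all hyperedges is conserved by the matches.  The
  measure \<open>\<mu>\<close> charges every node, so the weight of an arriving item is not almost surely \<open>0\<close>, and up to a
  sign it is a step of a random walk with nonnegative drift that moves up with positive probability.\<close>

lemma balanced_weight_imp_non_stabilizable: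
  fixes \<xi> :: "'a \<Rightarrow> int"
  assumes "hypergraph V H" and "{} \<notin> H"
    and balanced: "\<And>e. e \<in> H \<Longrightarrow> sum \<xi> e = 0"
    and bound: "\<And>x. \<bar>\<xi> x\<bar> \<le> 1"
    and nontrivial: "\<exists>x\<in>V. \<xi> x \<noteq> 0"
  shows "non_stabilizable V H"
proof -
  have finite: "finite V" "\<And>e. e \<in> H \<Longrightarrow> finite e"
    using assms(1) by (auto simp: hypergraph_def intro: finite_subset)
  have "\<not> stable V H \<Phi> \<mu>" if adm: "admissible V H \<Phi>" and \<mu>: "set_pmf \<mu> = V" for \<Phi> \<mu>
  proof -
    define mean where "mean \<eta> = (\<integral>x. real_of_int (\<eta> x) \<partial>\<mu>)" for \<eta> :: "'a \<Rightarrow> int"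
    have mean_sum: "mean \<eta> = (\<Sum>x\<in>V. pmf \<mu> x * real_of_int (\<eta> x))" for \<eta>
      unfolding mean_def using finite(1) \<mu> by (subst integral_measure_pmf[of V]) auto
    \<comment> \<open>The weight with the sign for which the walk does not drift to \<open>- \<infinity>\<close>.\<close>
    define \<zeta> where "\<zeta> = (if 0 \<le> mean \<xi> then \<xi> else (\<lambda>x. - \<xi> x))"
    have \<zeta>_mean: "0 \<le> mean \<zeta>"
      by (auto simp: \<zeta>_def mean_sum sum_negf)
    have \<zeta>_bound: "\<bar>\<zeta> x\<bar> \<le> 1" for x using bound[of x] by (simp add: \<zeta>_def)
    have \<zeta>_balanced: "sum \<zeta> e = 0" if "e \<in> H" for e
      using balanced[OF that] by (simp add: \<zeta>_def sum_negf)
    \<comment> \<open>Without up-steps, some node of weight \<open>- 1\<close> would make the drift negative.\<close>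
    obtain x where x: "x \<in> V" "\<zeta> x = 1"
    proof (rule ccontr)
      assume "\<not> thesis"
      then have nonpos: "\<zeta> x \<le> 0" if "x \<in> V" for x
        using \<zeta>_bound[of x] that \<open>\<And>x. x \<in> V \<Longrightarrow> \<zeta> x = 1 \<Longrightarrow> thesis\<close> by fastforce
      obtain y where y: "y \<in> V" "\<zeta> y \<noteq> 0"
        using nontrivial by (auto simp: \<zeta>_def)
      have "mean \<zeta> < (\<Sum>x\<in>V. 0)"
        unfolding mean_sum
      proof (rule sum_strict_mono_ex1[OF finite(1)])
        show "\<forall>x\<in>V. pmf \<mu> x * real_of_int (\<zeta> x) \<le> 0"
          using nonpos by (auto intro: mult_nonneg_nonpos)
        have "0 < pmf \<mu> y" using y(1) \<mu> by (simp add: pmf_positive)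
        moreover have "\<zeta> y < 0" using nonpos[OF y(1)] y(2) by linarith
        ultimately show "\<exists>x\<in>V. pmf \<mu> x * real_of_int (\<zeta> x) < 0"
          using y(1) by (auto simp: mult_less_0_iff)
      qed
      with \<zeta>_mean show False by simp
    qed
    define U where "U = uniform_measure lborel {0..1::real}"
    define M where "M = measure_pmf \<mu> \<Otimes>\<^sub>M U"
    interpret U: prob_space U
      unfolding U_def by (rule prob_space_uniform_measure) auto
    interpret pair: pair_prob_space "measure_pmf \<mu>" U ..
    interpret M: prob_space M
      unfolding M_def by (rule pair.P.prob_space_axioms)
    interpret sequence_space M ..
    have fst_M: "distr M (measure_pmf \<mu>) fst = measure_pmf \<mu>"
      unfolding M_def by (rule U.distr_pair_fst)
    have fst_meas [measurable]: "fst \<in> measurable M (measure_pmf \<mu>)"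
      unfolding M_def by (rule measurable_fst)
    define step where "step s = \<zeta> (fst s)" for s :: "'a \<times> real"
    have step_meas [measurable]: "step \<in> measurable M (count_space UNIV)"
      unfolding step_def by (rule measurable_compose[OF fst_meas]) simp
    have "(\<integral>s. real_of_int (step s) \<partial>M) = (\<integral>y. real_of_int (\<zeta> y) \<partial>distr M (measure_pmf \<mu>) fst)"
      unfolding step_def by (rule integral_distr[OF fst_meas, symmetric]) simp
    then have drift: "0 \<le> (\<integral>s. real_of_int (step s) \<partial>M)"
      using \<zeta>_mean by (simp add: fst_M mean_def)
    have "0 < emeasure (measure_pmf \<mu>) {x}"
      using x(1) \<mu> by (simp add: emeasure_pmf_single pmf_positive)
    also have "\<dots> \<le> emeasure (distr M (measure_pmf \<mu>) fst) {y. \<zeta> y = 1}"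
      unfolding fst_M using x(2) by (intro emeasure_mono) auto
    also have "\<dots> = emeasure M (fst -` {y. \<zeta> y = 1} \<inter> space M)"
      by (rule emeasure_distr[OF fst_meas]) simp
    also have "fst -` {y. \<zeta> y = 1} \<inter> space M = {s\<in>space M. step s = 1}"
      by (auto simp: step_def)
    finally have up: "0 < emeasure M {s\<in>space M. step s = 1}" .
    have input: "input_space \<mu> = S"
      by (simp add: input_space_def M_def U_def)
    have "AE s in measure_pmf \<mu> \<Otimes>\<^sub>M U. fst s \<in> V \<and> snd s \<in> {0..1}"
    proof (rule pair.AE_pair_measure)
      have "{s\<in>space (measure_pmf \<mu> \<Otimes>\<^sub>M U). fst s \<in> V \<and> snd s \<in> {0..1}} = V \<times> {0..1}"
        by (auto simp: space_pair_measure U_def)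
      also have "\<dots> \<in> sets (measure_pmf \<mu> \<Otimes>\<^sub>M U)"
        by (rule pair_measureI) (auto simp: U_def)
      finally show "{s\<in>space (measure_pmf \<mu> \<Otimes>\<^sub>M U). fst s \<in> V \<and> snd s \<in> {0..1}}
          \<in> sets (measure_pmf \<mu> \<Otimes>\<^sub>M U)" .
      have "AE u in U. u \<in> {0..1}"
        unfolding U_def by (rule AE_uniform_measureI) auto
      then show "AE x in measure_pmf \<mu>. AE u in U. fst (x, u) \<in> V \<and> snd (x, u) \<in> {0..1}"
        using \<mu> by (simp add: AE_measure_pmf_iff)
    qed
    then have "AE s in M. fst s \<in> V \<and> snd s \<in> {0..1}"
      unfolding M_def .
    then have "AE \<omega> in S. fst (\<omega> i) \<in> V \<and> snd (\<omega> i) \<in> {0..1}" for i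
      by (intro AE_PiM_component[where P = "\<lambda>s. fst s \<in> V \<and> snd s \<in> {0..1}"] M.prob_space_axioms) auto
    then have good: "AE \<omega> in S. \<forall>i. fst (\<omega> i) \<in> V \<and> snd (\<omega> i) \<in> {0..1}"
      by (simp add: AE_all_countable)
    have empty: "[] \<in> buffers V H"
      using assms(2) by (auto simp: buffers_def ex_in_conv)
    define B where "B n = {\<omega>\<in>space S. \<forall>k\<in>{1..n}. 0 < walk step \<omega> k}" for n
    have B_sets: "B n \<in> sets S" for n
      unfolding B_def Ball_def using pred_walk[OF step_meas] by (rule predE)
    have step_bound: "\<bar>step s\<bar> \<le> 1" for s
      unfolding step_def by (rule \<zeta>_bound)
    have "\<infinity> = (\<Sum>n. emeasure S (B n))"
      unfolding B_def by (rule suminf_emeasure_walk_positive[OF step_meas step_bound drift up, symmetric])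
    also have "\<dots> = (\<integral>\<^sup>+\<omega>. (\<Sum>n. indicator (B n) \<omega>) \<partial>S)"
    proof -
      have "(\<lambda>\<omega>. indicator (B n) \<omega> :: ennreal) \<in> borel_measurable S" for n
        by (rule borel_measurable_indicator[OF B_sets])
      then show ?thesis
        by (simp only: nn_integral_suminf nn_integral_indicator[OF B_sets])
    qed
    also have "\<dots> \<le> (\<integral>\<^sup>+\<omega>. return_time H \<Phi> [] \<omega> \<partial>S)"
    proof (rule nn_integral_mono_AE)
      show "AE \<omega> in S. (\<Sum>n. indicator (B n) \<omega>) \<le> return_time H \<Phi> [] \<omega>"
        using good
      proof eventually_elim
        case (elim \<omega>)
        show ?case
          unfolding B_def
        proof (rule return_time_ge)
          fix m assume "buffer_process H \<Phi> [] \<omega> m = []"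
          with buffer_process_weight[OF \<zeta>_balanced finite(2) adm empty, of \<omega> m] elim
          show "walk step \<omega> m = 0" by (simp add: step_def[abs_def])
        qed
      qed
    qed
    finally have "(\<integral>\<^sup>+\<omega>. return_time H \<Phi> [] \<omega> \<partial>input_space \<mu>) = \<infinity>"
      by (simp add: input top_unique)
    then have "\<not> (\<integral>\<^sup>+\<omega>. return_time H \<Phi> [] \<omega> \<partial>input_space \<mu>) < \<infinity>" by simp
    with empty show ?thesis unfolding stable_def by blast
  qed
  then show ?thesis by (auto simp: non_stabilizable_def Stab_def)
qed


section \<open>Cycles whose order is a multiple of the edge size\<close>

text \<open>Since \<open>r\<close> divides \<open>q\<close>, the residue modulo \<open>r\<close> of a position is well defined around the cycle, and
  \<open>r\<close> consecutive positions run through all residues once.\<close>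

lemma sum_cyclic_window_residues:
  fixes g :: "nat \<Rightarrow> 'b::comm_monoid_add"
  assumes "0 < q" "r dvd q" and inj: "inj_on v {..<q}"
    and f: "\<And>i. i < q \<Longrightarrow> f (v i) = g (i mod r)"
  shows "sum f (cyclic_window q v r t) = (\<Sum>i<r. g i)"
proof -
  have r: "0 < r" "r \<le> q" using assms(1,2) by (auto simp: dvd_imp_le intro: Nat.gr0I)
  have shift_inj: "inj_on (\<lambda>j. (t + j) mod r) {..<r}"
  proof (rule linorder_inj_onI)
    fix i j :: nat assume ij: "i < j" "j \<in> {..<r}"
    then have "\<not> r dvd (t + j) - (t + i)" by (auto dest: dvd_imp_le)
    with ij(1) show "(t + i) mod r \<noteq> (t + j) mod r"
      by (metis add_le_cancel_left less_imp_le mod_eq_dvd_iff_nat)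
  qed auto
  have window_inj: "inj_on (\<lambda>j. v ((t + j) mod q)) {..<r}"
  proof (rule inj_onI)
    fix i j assume ij: "i \<in> {..<r}" "j \<in> {..<r}" "v ((t + i) mod q) = v ((t + j) mod q)"
    then have "(t + i) mod q = (t + j) mod q"
      using inj assms(1) by (auto dest: inj_onD)
    then have "(t + i) mod q mod r = (t + j) mod q mod r" by simp
    then have "(t + i) mod r = (t + j) mod r"
      by (simp only: mod_mod_cancel[OF assms(2)])
    then show "i = j" using ij(1,2) by (rule inj_onD[OF shift_inj])
  qed
  have "sum f (cyclic_window q v r t) = (\<Sum>j<r. f (v ((t + j) mod q)))"
    unfolding cyclic_window_def by (subst sum.reindex[OF window_inj]) simp
  also have "\<dots> = (\<Sum>j<r. g ((t + j) mod r))"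
    using assms(1) by (simp add: f mod_mod_cancel[OF assms(2)])
  also have "\<dots> = (\<Sum>i\<in>(\<lambda>j. (t + j) mod r) ` {..<r}. g i)"
    by (simp add: sum.reindex[OF shift_inj])
  also have "(\<lambda>j. (t + j) mod r) ` {..<r} = {..<r}"
    using r(1) by (intro endo_inj_surj shift_inj) auto
  finally show ?thesis .
qed

theorem proposition4p10:
  fixes V :: "'a set" and H :: "'a set set" and r l q :: nat
  assumes "hypergraph V H"
    and "simple_hypergraph H"
    and "connected_hypergraph H"
    and "hamiltonian_cycle r l V H"
    and "card V = q"
    and "r dvd q"
  shows "non_stabilizable V H"
proof (cases "V = {}")
  case True
  then show ?thesis
    by (auto simp: non_stabilizable_def Stab_def set_pmf_not_empty)
next
  case False
  from assms(4) have r: "2 \<le> r" and uniform: "uniform_hypergraph r H"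
    by (auto simp: hamiltonian_cycle_def)
  from assms(4) obtain v and s :: "nat \<Rightarrow> nat" and m :: nat where v: "bij_betw v {..<q} V"
    and windows: "bij_betw (\<lambda>k. cyclic_window q v r (s k)) {..<m} H"
    unfolding hamiltonian_cycle_def assms(5) by blast
  have q: "0 < q"
    using False assms(1,5) by (auto simp: hypergraph_def card_gt_0_iff)
  define g :: "nat \<Rightarrow> int" where "g i = (if i = 0 then 1 else if i = 1 then - 1 else 0)" for i
  define \<xi> where "\<xi> x = g (inv_into {..<q} v x mod r)" for x
  have \<xi>_v: "\<xi> (v i) = g (i mod r)" if "i < q" for i
    using v that by (simp add: \<xi>_def bij_betw_def inv_into_f_f)
  have g_sum: "(\<Sum>i<r. g i) = 0"
  proof -
    have "(\<Sum>i<r. g i) = (\<Sum>i\<in>{0, 1}. g i)"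
      using r by (intro sum.mono_neutral_right) (auto simp: g_def)
    then show ?thesis by (simp add: g_def)
  qed
  show ?thesis
  proof (rule balanced_weight_imp_non_stabilizable[OF assms(1)])
    show "{} \<notin> H" using uniform r by (force simp: uniform_hypergraph_def)
    show "\<bar>\<xi> x\<bar> \<le> 1" for x by (simp add: \<xi>_def g_def)
    show "\<exists>x\<in>V. \<xi> x \<noteq> 0"
    proof
      show "v 0 \<in> V" using v q by (auto simp: bij_betw_def)
      show "\<xi> (v 0) \<noteq> 0" using \<xi>_v[OF q] by (simp add: g_def)
    qed
    fix e assume "e \<in> H"
    with windows obtain k where "e = cyclic_window q v r (s k)"
      by (auto simp: bij_betw_def)
    with sum_cyclic_window_residues[OF q assms(6) bij_betw_imp_inj_on[OF v], where f = \<xi> and g = g, OF \<xi>_v] g_sum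
    show "sum \<xi> e = 0" by simp
  qed
qed

end
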